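(* Let $K>1$, $\theta\in(-\pi/2,\pi/2]$ and $c\in\mathbb{C}$, and let $H_{K,\theta,c}(z)=\left[\left(\frac{K+1}{2}\right)z+e^{2i\theta}\left(\frac{K-1}{2}\right)\overline{z}\right]^2+c$. If $c\in\mathcal{M}_{K,\theta}$, then $\partial I(H_{K,\theta,c})$ is connected. If $c\notin\mathcal{M}_{K,\theta}$, then $\partial I(H_{K,\theta,c})$ has uncountably many connected components.
   Context: For a map $f:\mathbb{C}\to\mathbb{C}$, $f^n$ denotes the $n$-th iterate. The escaping set is $I(f)=\{z\in\mathbb{C}: f^n(z)\to\infty\}$ and the bounded orbit set is $BO(f)=\{z\in\mathbb{C}: \exists M>0 \text{ with } |f^n(z)|\le M \text{ for all } n\in\mathbb{N}\}$. The Mandelbrot set is $\mathcal{M}_{K,\theta}=\{c\in\mathbb{C}: 0\in BO(H_{K,\theta,c})\}$. *)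

theory Defs
  imports "HOL-Analysis.Analysis"
begin

definition escaping_set :: "(complex \<Rightarrow> complex) \<Rightarrow> complex set" where
  "escaping_set f = {z. filterlim (\<lambda>n. (f ^^ n) z) at_infinity sequentially}"

definition bounded_orbit_set :: "(complex \<Rightarrow> complex) \<Rightarrow> complex set" where
  "bounded_orbit_set f = {z. \<exists>M>0. \<forall>n. cmod ((f ^^ n) z) \<le> M}"

definition H_map :: "real \<Rightarrow> real \<Rightarrow> complex \<Rightarrow> complex \<Rightarrow> complex" where
  "H_map K \<theta> c z =
    (of_real ((K + 1) / 2) * z
      + exp (2 * \<i> * of_real \<theta>) * of_real ((K - 1) / 2) * cnj z)\<^sup>2 + c"

definition mandelbrot_set :: "real \<Rightarrow> real \<Rightarrow> complex set" where
  "mandelbrot_set K \<theta> = {c. 0 \<in> bounded_orbit_set (H_map K \<theta> c)}"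

end

theory Submission
  imports Defs "HOL-Complex_Analysis.Conformal_Mappings"
begin

text \<open>
  The map \<open>H\<close> is a linear automorphism of the plane followed by a quadratic polynomial, so it is a
  continuous open map that expands near infinity, and the escaping set is the complement of the
  compact bounded orbit set \<open>BO\<close>. Openness gives a maximum principle, so the escaping set is
  connected. If the critical value \<open>c\<close> lies in \<open>BO\<close>, it lies in all preimages \<open>H\<^sup>-\<^sup>n(D)\<close> of a large
  disc \<open>D\<close>, which are then connected: a splitting of the next preimage would put \<open>c\<close> in the images
  of both parts, although \<open>c\<close> has only one preimage. Their intersection \<open>BO\<close> is thus connected, and
  its frontier is connected since the plane is unicoherent.

  If \<open>c\<close> escapes, then \<open>c\<close> lies in the unbounded component of the complement of \<open>BO\<close>, so
  \<open>z - c\<close> has a continuous square root on \<open>BO\<close>. This splits \<open>BO\<close> into disjoint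
  compact sets \<open>A\<close> and \<open>-A\<close>, each mapped onto \<open>BO\<close>. Points with different itineraries with respect
  to this splitting lie in different components, all itineraries occur, and every itinerary class
  meets the frontier.
\<close>

section \<open>Preimages under open maps\<close>

text \<open>Either piece of a separation of the preimage has an image that is compact and relatively
  open in \<open>E\<close>, hence equal to \<open>E\<close>. Both pieces would then contain a point
  over \<open>f a\<close>, yet \<open>a\<close> is the only one.\<close>

lemma connected_vimage_open_map:
  fixes f :: "'a::metric_space \<Rightarrow> 'b::metric_space"
  assumes cont: "continuous_on UNIV f"
    and open_map: "\<And>S. open S \<Longrightarrow> open (f ` S)"
    and comp: "compact (f -` E)"
    and E: "connected E" "f a \<in> E"
    and inj_at: "\<And>z. f z = f a \<Longrightarrow> z = a"
  shows "connected (f -` E)"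
proof (rule ccontr)
  have onto: "f a \<in> f ` B"
    if AB: "closed A" "closed B" "B \<noteq> {}" "A \<union> B = f -` E" "A \<inter> B = {}" for A B
  proof -
    have "compact B"
      using compact_Int_closed[OF comp AB(2)] AB(4) by (metis Int_absorb1 Un_upper2)
    then have "closed (f ` B)"
      by (meson cont compact_continuous_image compact_imp_closed continuous_on_subset subset_UNIV)
    then have "closedin (top_of_set E) (f ` B)"
      using AB by (intro closed_subset) auto
    \<comment> \<open>The open set \<open>- A\<close> adds to \<open>B\<close> only points mapped
      outside \<open>E\<close>.\<close>
    moreover have "f ` B = E \<inter> f ` (- A)"
      using AB by auto
    then have "openin (top_of_set E) (f ` B)"
      using open_map[of "- A"] AB by (metis open_Compl openin_open_Int)
    ultimately have "f ` B = E"
      using E(1) AB(3) unfolding connected_clopen by (metis image_is_empty)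
    with E show ?thesis by simp
  qed
  assume "\<not> connected (f -` E)"
  then obtain A B where AB: "closed A" "closed B" "A \<noteq> {}" "B \<noteq> {}" "A \<union> B = f -` E" "A \<inter> B = {}"
    using connected_closed_set[OF compact_imp_closed[OF comp]] by blast
  have "f a \<in> f ` A" "f a \<in> f ` B"
    using onto[of B A] onto[of A B] AB by (auto simp: Un_commute Int_commute)
  with inj_at AB(6) show False by (metis disjoint_iff imageE)
qed

text \<open>By Borsuk's criterion the direction of \<open>z - c\<close> is an inessential circle map
  on \<open>S\<close>, so it has a continuous argument \<open>g\<close>; halving \<open>g\<close>
  gives the root.\<close>

lemma continuous_square_root_off_unbounded_component:
  fixes c :: complex
  assumes "compact S" "c \<notin> S" "\<not> bounded (connected_component_set (- S) c)"
  obtains s where "continuous_on S s" "\<And>z. z \<in> S \<Longrightarrow> (s z)\<^sup>2 = z - c"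
proof -
  have "\<exists>a. homotopic_with_canon (\<lambda>x. True) S (sphere 0 1)
           (\<lambda>x. inverse (norm (x - c)) *\<^sub>R (x - c)) (\<lambda>x. a)"
    using Borsuk_map_essential_bounded_component[OF assms(1,2)] assms(3) by blast
  then obtain g where g: "continuous_on S g"
    "\<And>z. z \<in> S \<Longrightarrow> inverse (norm (z - c)) *\<^sub>R (z - c) = exp (\<i> * of_real (g z :: real))"
    unfolding inessential_eq_continuous_logarithm_circle by blast
  show thesis
  proof
    show "continuous_on S (\<lambda>z. of_real (sqrt (norm (z - c))) * exp (\<i> * of_real (g z) / 2))"
      by (intro continuous_intros g) simp
    fix z assume z: "z \<in> S"
    have "(of_real (sqrt (norm (z - c))))\<^sup>2 = (of_real (norm (z - c)) :: complex)"
      by (simp flip: of_real_power)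
    moreover have "(exp (\<i> * of_real (g z) / 2))\<^sup>2 = exp (\<i> * of_real (g z))"
      by (simp flip: exp_double)
    ultimately have "(of_real (sqrt (norm (z - c))) * exp (\<i> * of_real (g z) / 2))\<^sup>2
        = of_real (norm (z - c)) * (inverse (norm (z - c)) *\<^sub>R (z - c))"
      using g(2)[OF z] by (simp add: power_mult_distrib)
    also have "\<dots> = z - c"
    proof -
      have "z - c \<noteq> 0"
        using z assms(2) by auto
      then show ?thesis
        by (simp add: scaleR_conv_of_real)
    qed
    finally show "(of_real (sqrt (norm (z - c))) * exp (\<i> * of_real (g z) / 2))\<^sup>2 = z - c" .
  qed
qed

section \<open>Open maps expanding near infinity\<close>

locale expanding_open_map =
  fixes f :: "complex \<Rightarrow> complex" and R :: real
  assumes cont: "continuous_on UNIV f"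
    and open_map: "\<And>S. open S \<Longrightarrow> open (f ` S)"
    and surj_map: "surj f"
    and R_pos: "R > 0"
    and expand: "\<And>z. norm z \<ge> R \<Longrightarrow> norm (f z) \<ge> 2 * norm z"
begin

section \<open>Iterates and the dichotomy between escape and bounded orbits\<close>

lemma continuous_funpow: "continuous_on UNIV (f ^^ n)"
proof (induction n)
  case (Suc n)
  then show ?case
    by (auto simp: o_def intro: continuous_on_compose2[OF cont])
qed (simp add: continuous_on_id)

lemma open_map_funpow: "open S \<Longrightarrow> open ((f ^^ n) ` S)"
proof (induction n)
  case (Suc n)
  then show ?case
    using open_map[of "(f ^^ n) ` S"] by (simp add: image_image)
qed simp

lemma surj_funpow: "surj (f ^^ n)"
proof (induction n)
  case (Suc n)
  then show ?case
    using comp_surj[OF _ surj_map] by (simp only: funpow.simps)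
qed simp

lemma norm_funpow_ge: "norm z \<ge> R \<Longrightarrow> norm ((f ^^ n) z) \<ge> 2 ^ n * norm z"
proof (induction n)
  case (Suc n)
  \<comment> \<open>The iterate stays outside radius \<open>R\<close>, so \<open>expand\<close>
    applies once more.\<close>
  have "1 * norm z \<le> 2 ^ n * norm z"
    by (intro mult_right_mono) simp_all
  with Suc have "norm ((f ^^ n) z) \<ge> R" by simp
  from expand[OF this] Suc show ?case by simp
qed simp

lemma filterlim_funpow_at_infinity:
  assumes "norm ((f ^^ m) z) > R"
  shows "filterlim (\<lambda>n. (f ^^ n) z) at_infinity sequentially"
proof -
  have "filterlim (\<lambda>n. (2::real) ^ n) at_top sequentially"
    using filterlim_at_infinity_imp_norm_at_top[OF filterlim_realpow_sequentially_gt1[of "2::real"]]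
    by (simp add: norm_power)
  then have "filterlim (\<lambda>n. 2 ^ n * norm ((f ^^ m) z)) at_top sequentially"
    using assms R_pos by (intro filterlim_at_top_mult_tendsto_pos[OF tendsto_const]) auto
  then have "filterlim (\<lambda>n. norm ((f ^^ n) ((f ^^ m) z))) at_top sequentially"
    by (rule filterlim_at_top_mono) (use norm_funpow_ge assms in simp)
  then have "filterlim (\<lambda>n. (f ^^ (n + m)) z) at_infinity sequentially"
    by (intro filterlim_norm_at_top_imp_at_infinity) (simp add: funpow_add)
  moreover have "(\<forall>\<^sub>F n in sequentially. P ((f ^^ (n + m)) z)) \<longleftrightarrow>
      (\<forall>\<^sub>F n in sequentially. P ((f ^^ n) z))" for P
    by (rule eventually_sequentially_seg)
  ultimately show ?thesis
    by (simp only: filterlim_iff)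
qed

lemma not_filterlim_at_infinity_bounded:
  assumes "\<And>n. norm ((f ^^ n) z) \<le> M"
  shows "\<not> filterlim (\<lambda>n. (f ^^ n) z) at_infinity sequentially"
proof
  assume "filterlim (\<lambda>n. (f ^^ n) z) at_infinity sequentially"
  then have "\<forall>\<^sub>F n in sequentially. norm ((f ^^ n) z) \<ge> \<bar>M\<bar> + 1"
    unfolding filterlim_at_infinity[OF order_refl] by simp
  then obtain n where "norm ((f ^^ n) z) \<ge> \<bar>M\<bar> + 1"
    unfolding eventually_sequentially by blast
  with assms[of n] show False by linarith
qed

text \<open>Exceeding \<open>R\<close> once forces escape, so any bound on an orbit improves to the
  uniform bound \<open>R\<close>.\<close>

lemma bounded_orbit_set_eq: "bounded_orbit_set f = {z. \<forall>n. norm ((f ^^ n) z) \<le> R}"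
proof -
  have "norm ((f ^^ n) z) \<le> R" if "\<And>n. norm ((f ^^ n) z) \<le> M" for z n M
    using not_filterlim_at_infinity_bounded[OF that] filterlim_funpow_at_infinity not_le by blast
  then show ?thesis
    using R_pos unfolding bounded_orbit_set_def by blast
qed

lemma escaping_set_eq: "escaping_set f = - bounded_orbit_set f"
proof -
  have "filterlim (\<lambda>n. (f ^^ n) z) at_infinity sequentially \<longleftrightarrow> \<not> (\<forall>n. norm ((f ^^ n) z) \<le> R)" for z
    using filterlim_funpow_at_infinity not_filterlim_at_infinity_bounded not_le by metis
  then show ?thesis
    unfolding bounded_orbit_set_eq escaping_set_def by blast
qed

lemma vimage_bounded_orbit_set: "f -` bounded_orbit_set f = bounded_orbit_set f"
proof -
  \<comment> \<open>This recovers the bound at time 0, about which the orbit of \<open>f z\<close>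
    says nothing directly.\<close>
  have "norm z \<le> R" if "norm (f z) \<le> R" for z
    using expand[of z] that R_pos by (cases "norm z \<le> R") auto
  then have "(\<forall>n. norm ((f ^^ n) (f z)) \<le> R) \<longleftrightarrow> (\<forall>n. norm ((f ^^ n) z) \<le> R)" for z
    by (metis funpow_0 funpow_simps_right(2) not0_implies_Suc o_apply)
  then show ?thesis by (auto simp: bounded_orbit_set_eq)
qed

section \<open>Compact approximations of the bounded orbit set and connectedness\<close>

text \<open>Only the \<open>n\<close>-th iterate is constrained, so each level is the full preimage
  of the previous one; nesting comes from expansion.\<close>

definition level :: "nat \<Rightarrow> complex set" where
  "level n = (f ^^ n) -` cball 0 R"

lemma level_Suc: "level (Suc n) = f -` level n"
  unfolding level_def by (simp add: funpow_Suc_right vimage_comp del: funpow.simps)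

lemma level_antimono: "m \<le> n \<Longrightarrow> level n \<subseteq> level m"
proof (rule lift_Suc_antimono_le[of level])
  show "level (Suc n) \<subseteq> level n" for n
  proof
    fix z assume "z \<in> level (Suc n)"
    then show "z \<in> level n"
      using expand[of "(f ^^ n) z"] R_pos
      by (cases "norm ((f ^^ n) z) \<le> R") (auto simp: level_def)
  qed
qed

lemma compact_level: "compact (level n)"
proof -
  have "closed (level n)"
    unfolding level_def by (intro closed_vimage continuous_funpow closed_cball)
  moreover have "level n \<subseteq> cball 0 R"
    using level_antimono[of 0 n] by (simp add: level_def)
  ultimately show ?thesis
    using bounded_cball bounded_subset compact_eq_bounded_closed by blast
qed

lemma level_nonempty: "level n \<noteq> {}"
proof -
  obtain z where "(f ^^ n) z = 0"
    using surj_funpow[of n] by (metis surjD)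
  with R_pos have "z \<in> level n"
    by (simp add: level_def)
  then show ?thesis by blast
qed

lemma bounded_orbit_set_eq_level: "bounded_orbit_set f = (\<Inter>n. level n)"
  by (auto simp: bounded_orbit_set_eq level_def)

lemma compact_bounded_orbit_set: "compact (bounded_orbit_set f)"
  unfolding bounded_orbit_set_eq_level using compact_level by (intro compact_Inter) auto

lemma bounded_orbit_set_nonempty: "bounded_orbit_set f \<noteq> {}"
  unfolding bounded_orbit_set_eq_level
  by (intro compact_nest compact_level level_nonempty level_antimono)

text \<open>
  Maximum principle: the frontier of the image of a bounded open set under an iterate lies in the
  image of the frontier, so a bounded complementary component would not escape.
\<close>

lemma unbounded_component_escaping:
  assumes C: "C \<in> components (- bounded_orbit_set f)"
  shows "\<not> bounded C"
proof
  assume bdd: "bounded C"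
  have "open (- bounded_orbit_set f)"
    by (simp add: compact_bounded_orbit_set compact_imp_closed open_Compl)
  then have "open C"
    using C open_components by blast
  have front: "frontier C \<subseteq> bounded_orbit_set f"
    by (rule frontier_of_components_closed_complement[OF compact_imp_closed[OF compact_bounded_orbit_set] C])
  have "norm ((f ^^ n) z) \<le> R" if "z \<in> C" for z n
  proof (rule ccontr)
    let ?g = "f ^^ n"
    assume "\<not> norm (?g z) \<le> R"
    then have meets: "- cball 0 R \<inter> ?g ` C \<noteq> {}"
      using that by auto
    have "compact (?g ` closure C)"
      using bdd by (intro compact_continuous_image continuous_on_subset[OF continuous_funpow]) auto
    moreover have "?g ` C \<subseteq> ?g ` closure C"
      by (intro image_mono closure_subset)
    ultimately have sub: "closure (?g ` C) \<subseteq> ?g ` closure C" and "bounded (?g ` C)"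
      by (auto intro: closure_minimal[THEN subsetD] compact_imp_closed
          bounded_subset[OF compact_imp_bounded])
    \<comment> \<open>The exterior of the disc is connected and meets the image, but is too large to
      lie inside it; hence it contains a frontier point \<open>w\<close> of the image.\<close>
    then have "\<not> - cball 0 R \<subseteq> ?g ` C"
      using bounded_subset cobounded_imp_unbounded bounded_cball by (metis double_complement)
    then have "- cball 0 R - ?g ` C \<noteq> {}"
      by auto
    moreover have "connected (- cball (0::complex) R)"
      by (intro connected_complement_bounded_convex) auto
    ultimately obtain w where w: "w \<in> - cball 0 R" "w \<in> frontier (?g ` C)"
      using connected_Int_frontier[OF _ meets] by blast
    have "w \<notin> ?g ` C"
      using w(2) open_map_funpow[OF \<open>open C\<close>] frontier_disjoint_eq by blast
    moreover have "w \<in> ?g ` closure C"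
      using w(2) sub by (auto simp: frontier_def)
    ultimately obtain u where "u \<in> frontier C" "w = ?g u"
      using \<open>open C\<close> by (auto simp: frontier_def interior_open)
    then show False
      using front w(1) by (auto simp: bounded_orbit_set_eq)
  qed
  then have "C \<subseteq> bounded_orbit_set f"
    by (auto simp: bounded_orbit_set_eq)
  then show False
    using C in_components_nonempty in_components_subset by blast
qed

text \<open>In the plane, the complement of a bounded set has only one unbounded component.\<close>

lemma connected_Compl_bounded_orbit_set: "connected (- bounded_orbit_set f)"
  unfolding connected_eq_connected_components_eq
  by (intro ballI cobounded_unique_unbounded_components[of "- bounded_orbit_set f"])
     (use unbounded_component_escaping compact_imp_bounded[OF compact_bounded_orbit_set] in auto)

text \<open>The value \<open>f a\<close> lies in every level, so connectedness passes from each
  level to its preimage, and then to the nested compact intersection.\<close>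

lemma connected_bounded_orbit_set:
  assumes c: "f a \<in> bounded_orbit_set f" and inj_at: "\<And>z. f z = f a \<Longrightarrow> z = a"
  shows "connected (bounded_orbit_set f)"
proof -
  have "connected (level n)" for n
  proof (induction n)
    case (Suc n)
    show ?case
      unfolding level_Suc
    proof (rule connected_vimage_open_map[OF cont open_map _ Suc _ inj_at])
      show "compact (f -` level n)"
        using compact_level[of "Suc n"] by (simp add: level_Suc)
      show "f a \<in> level n"
        using c by (simp add: bounded_orbit_set_eq_level)
    qed auto
  qed (simp add: level_def)
  then show ?thesis
    unfolding bounded_orbit_set_eq_level by (intro connected_nest compact_level level_antimono)
qed

section \<open>Itineraries and uncountably many components\<close>

lemma uncountable_components_of_splitting:
  assumes A: "compact A" and B: "compact B" and disj: "A \<inter> B = {}"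
    and split: "A \<union> B = bounded_orbit_set f"
    and fA: "f ` A = bounded_orbit_set f" and fB: "f ` B = bounded_orbit_set f"
  shows "uncountable (components (frontier (bounded_orbit_set f)))"
proof -
  let ?BO = "bounded_orbit_set f"
  define P where "P b = (if b then A else B)" for b
  \<comment> \<open>\<open>T s n\<close> prescribes the first \<open>n\<close> symbols of the
    itinerary, \<open>S s\<close> all of them.\<close>
  define T where "T s n = {z \<in> ?BO. \<forall>k<n. (f ^^ k) z \<in> P (s k)}" for s :: "nat \<Rightarrow> bool" and n :: nat
  define S where "S s = (\<Inter>n. T s n)" for s
  have P: "compact (P b)" "f ` P b = ?BO" "P b \<subseteq> ?BO" for b
    using A B fA fB split by (auto simp: P_def)
  have T_compact: "compact (T s n)" for s n
  proof -
    have "T s n = ?BO \<inter> (\<Inter>k\<in>{..<n}. (f ^^ k) -` P (s k))"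
      by (auto simp: T_def)
    moreover have "closed (\<Inter>k\<in>{..<n}. (f ^^ k) -` P (s k))"
      using P by (intro closed_INT ballI closed_vimage continuous_funpow compact_imp_closed)
    ultimately show ?thesis
      using compact_bounded_orbit_set by (simp add: compact_Int_closed)
  qed
  have T_nonempty: "T s n \<noteq> {}" for s n
  \<comment> \<open>The induction hypothesis is used for the shifted sequence; a point realising it
    is pulled back into \<open>P (s 0)\<close>.\<close>
  proof (induction n arbitrary: s)
    case 0
    then show ?case using bounded_orbit_set_nonempty by (auto simp: T_def)
  next
    case (Suc n)
    then obtain w where w: "w \<in> ?BO" "\<And>k. k < n \<Longrightarrow> (f ^^ k) w \<in> P (s (Suc k))"
      by (fastforce simp: T_def)
    then have "w \<in> f ` P (s 0)"
      using P(2) by simp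
    then obtain z where z: "z \<in> P (s 0)" "f z = w"
      by blast
    have "(f ^^ k) z \<in> P (s k)" if "k < Suc n" for k
      using that w z by (cases k) (auto simp: funpow_Suc_right simp del: funpow.simps(2))
    then have "z \<in> T s (Suc n)"
      using z P(3) by (auto simp: T_def)
    then show ?case by blast
  qed
  have S_nonempty: "S s \<noteq> {}" for s
    unfolding S_def by (rule compact_nest[OF T_compact T_nonempty]) (auto simp: T_def)
  have S_compact: "compact (S s)" for s
    unfolding S_def using T_compact by (intro compact_Inter) auto
  have S_eq: "S s = {z \<in> ?BO. \<forall>k. (f ^^ k) z \<in> P (s k)}" for s
    by (auto simp: S_def T_def)
  \<comment> \<open>A connected subset of \<open>?BO\<close> cannot meet both disjoint closed pieces
    at any time, so its points share one itinerary.\<close>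
  have itinerary: "X \<subseteq> S s" if X: "connected X" "X \<subseteq> ?BO" "z \<in> X" "z \<in> S s" for X z s
  proof -
    have "(f ^^ k) x \<in> P (s k)" if "x \<in> X" for x k
    proof -
      have inv: "(f ^^ k) x \<in> ?BO" if "x \<in> ?BO" for x
        using that vimage_bounded_orbit_set by (induction k) auto
      have "connected ((f ^^ k) ` X)"
        using X(1) by (intro connected_continuous_image continuous_on_subset[OF continuous_funpow]) auto
      moreover have "(f ^^ k) ` X \<subseteq> P (s k) \<union> P (\<not> s k)"
        using inv X(2) split by (auto simp: P_def)
      moreover have "P (s k) \<inter> P (\<not> s k) \<inter> (f ^^ k) ` X = {}"
        using disj by (auto simp: P_def)
      moreover have "P (s k) \<inter> (f ^^ k) ` X \<noteq> {}"
        using X by (auto simp: S_eq)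
      ultimately have "P (\<not> s k) \<inter> (f ^^ k) ` X = {}"
        using connected_closedD[of "(f ^^ k) ` X" "P (s k)" "P (\<not> s k)"] P(1) compact_imp_closed
        by blast
      then show ?thesis
        using \<open>(f ^^ k) ` X \<subseteq> P (s k) \<union> P (\<not> s k)\<close> that by blast
    qed
    then show ?thesis
      using X(2) by (auto simp: S_eq)
  qed
  \<comment> \<open>Otherwise each point of \<open>S s\<close> has a ball inside \<open>?BO\<close>,
    which follows the same itinerary; \<open>S s\<close> would be nonempty, open and compact in the
    plane.\<close>
  have "S s \<inter> frontier ?BO \<noteq> {}" for s
  proof
    assume none: "S s \<inter> frontier ?BO = {}"
    have "open (S s)"
      unfolding open_contains_ball
    proof
      fix z assume z: "z \<in> S s"
      then have "z \<in> interior ?BO"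
        using none closure_subset[of ?BO] by (auto simp: S_eq frontier_def)
      then obtain e where "e > 0" "ball z e \<subseteq> ?BO"
        by (auto simp: mem_interior)
      then show "\<exists>e>0. ball z e \<subseteq> S s"
        using itinerary[OF connected_ball _ _ z] by (metis centre_in_ball)
    qed
    then have "S s = UNIV"
      using S_nonempty S_compact compact_imp_closed clopen by blast
    then show False
      using S_compact[of s] not_compact_UNIV by simp
  qed
  then have "\<forall>s. \<exists>z. z \<in> S s \<and> z \<in> frontier ?BO"
    by blast
  then obtain p where p: "\<And>s. p s \<in> S s" "\<And>s. p s \<in> frontier ?BO"
    by metis
  define F where "F s = connected_component_set (frontier ?BO) (p s)" for s
  have F_sub: "F s \<subseteq> S s" for s
  proof (rule itinerary)
    show "F s \<subseteq> ?BO"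
      using frontier_subset_compact[OF compact_bounded_orbit_set] connected_component_subset
      unfolding F_def by blast
    show "p s \<in> F s"
      using p by (simp add: F_def)
  qed (use p in \<open>auto simp: F_def\<close>)
  have "inj F"
  proof (rule injI)
    fix s t assume "F s = F t"
    moreover have "p s \<in> F s"
      using p by (simp add: F_def)
    ultimately have st: "p s \<in> S s" "p s \<in> S t"
      using F_sub by blast+
    show "s = t"
    proof
      fix k
      have "(f ^^ k) (p s) \<in> P (s k) \<inter> P (t k)"
        using st by (simp add: S_eq)
      then show "s k = t k"
        using disj by (auto simp: P_def split: if_splits)
    qed
  qed
  moreover have "range F \<subseteq> components (frontier ?BO)"
    using p by (auto simp: F_def intro: componentsI)
  \<comment> \<open>Cantor's diagonal argument.\<close>
  moreover have "uncountable (UNIV :: (nat \<Rightarrow> bool) set)"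
  proof
    assume "countable (UNIV :: (nat \<Rightarrow> bool) set)"
    then obtain e :: "nat \<Rightarrow> nat \<Rightarrow> bool" where "range e = UNIV"
      by (metis UNIV_not_empty uncountable_def)
    then obtain n where "e n = (\<lambda>k. \<not> e k k)"
      by (metis UNIV_I imageE)
    then show False by metis
  qed
  ultimately show ?thesis
    by (meson countable_image_inj_on countable_subset)
qed

end

section \<open>The quadratic maps\<close>

text \<open>The real-linear map that stretches by \<open>K\<close> in the direction e^(i\<theta>)
  and fixes the orthogonal direction.\<close>

definition stretch :: "real \<Rightarrow> real \<Rightarrow> complex \<Rightarrow> complex" where
  "stretch K \<theta> z = of_real ((K + 1) / 2) * z
      + exp (2 * \<i> * of_real \<theta>) * of_real ((K - 1) / 2) * cnj z"

lemma H_map_eq: "H_map K \<theta> c z = (stretch K \<theta> z)\<^sup>2 + c"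
  by (simp add: H_map_def stretch_def)

lemma linear_stretch: "linear (stretch K \<theta>)"
  unfolding stretch_def by (rule linearI) (simp_all add: algebra_simps scaleR_conv_of_real add_divide_distrib diff_divide_distrib)

text \<open>The two summands have norms (K+1)/2 and (K-1)/2 times \<open>norm z\<close>, which
  differ by exactly \<open>norm z\<close>.\<close>

lemma norm_stretch_ge:
  assumes "K > 1"
  shows "norm (stretch K \<theta> z) \<ge> norm z"
proof -
  have "norm (exp (2 * \<i> * of_real \<theta>)) = 1"
    using norm_exp_i_times[of "2 * \<theta>"] by (simp add: mult.commute mult.left_commute)
  then have "norm (exp (2 * \<i> * of_real \<theta>) * of_real ((K - 1) / 2) * cnj z) = (K - 1) / 2 * norm z"
    using assms by (simp add: norm_mult norm_divide del: of_real_divide of_real_diff)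
  moreover have "norm (of_real ((K + 1) / 2) * z) = (K + 1) / 2 * norm z"
    using assms by (simp add: norm_mult del: of_real_divide of_real_add)
  ultimately have "norm (stretch K \<theta> z) \<ge> (K + 1) / 2 * norm z - (K - 1) / 2 * norm z"
    unfolding stretch_def by (metis norm_diff_ineq)
  then show ?thesis by (simp add: field_simps)
qed

lemma inj_stretch: "K > 1 \<Longrightarrow> inj (stretch K \<theta>)"
  unfolding linear_injective_0[OF linear_stretch]
  using norm_stretch_ge by (metis norm_le_zero_iff norm_zero)

lemma surj_stretch: "K > 1 \<Longrightarrow> surj (stretch K \<theta>)"
  by (simp add: linear_injective_imp_surjective linear_stretch inj_stretch)

lemma open_image_square:
  fixes S :: "complex set"
  assumes "open S"
  shows "open ((\<lambda>z. z\<^sup>2) ` S)"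
proof (rule open_mapping_thm2[of _ UNIV])
  fix X :: "complex set"
  assume X: "open X" "X \<noteq> {}"
  show "\<not> (\<lambda>z. z\<^sup>2) constant_on X"
  proof
    assume "(\<lambda>z. z\<^sup>2) constant_on X"
    then obtain w where w: "\<And>z. z \<in> X \<Longrightarrow> z\<^sup>2 = w"
      by (auto simp: constant_on_def)
    \<comment> \<open>A value has at most two square roots, whereas nonempty open sets are
      infinite.\<close>
    have "X \<subseteq> {csqrt w, - csqrt w}"
      using w by (metis insertCI power2_csqrt power2_eq_iff subsetI)
    then have "finite X"
      by (rule finite_subset) simp
    with X show False
      using finite_imp_not_open by blast
  qed
qed (use assms in \<open>auto intro!: holomorphic_intros\<close>)

lemma expanding_open_map_H_map:
  assumes "K > 1"
  shows "expanding_open_map (H_map K \<theta> c) (norm c + 2)"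
proof
  show "continuous_on UNIV (H_map K \<theta> c)"
    unfolding H_map_def by (intro continuous_intros)
  show "open (H_map K \<theta> c ` S)" if "open S" for S
  proof -
    have "H_map K \<theta> c ` S = (+) c ` (\<lambda>z. z\<^sup>2) ` stretch K \<theta> ` S"
      by (simp add: image_image H_map_eq add.commute)
    with that show ?thesis
      by (simp add: open_translation open_image_square open_surjective_linear_image
          linear_stretch surj_stretch assms)
  qed
  show "surj (H_map K \<theta> c)"
    unfolding surj_def
  proof
    fix y
    obtain z where "stretch K \<theta> z = csqrt (y - c)"
      using surj_stretch[OF assms] by (metis surj_def)
    then have "y = H_map K \<theta> c z"
      by (simp add: H_map_eq)
    then show "\<exists>z. y = H_map K \<theta> c z" ..
  qed
  show "norm c + 2 > 0"
    using norm_ge_zero[of c] by linarith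
  \<comment> \<open>The radius gives |H(z)| \<ge> (|c| + 2)|z| - |c|, and |z| \<ge> 1 absorbs the
    last term.\<close>
  show "2 * norm z \<le> norm (H_map K \<theta> c z)" if z: "norm c + 2 \<le> norm z" for z
  proof -
    have "(norm c + 2) * norm z \<le> (norm z)\<^sup>2"
      using z by (simp add: power2_eq_square mult_right_mono)
    also have "\<dots> \<le> (norm (stretch K \<theta> z))\<^sup>2"
      by (simp add: norm_stretch_ge assms power_mono)
    also have "\<dots> - norm c \<le> norm (H_map K \<theta> c z)"
      unfolding H_map_eq norm_power[symmetric] by (rule norm_diff_ineq)
    finally have "(norm c + 2) * norm z - norm c \<le> norm (H_map K \<theta> c z)" by simp
    moreover have "norm c * 1 \<le> norm c * norm z"
      using z norm_ge_zero[of c] by (intro mult_left_mono) linarith+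
    ultimately show ?thesis by (simp add: algebra_simps)
  qed
qed

text \<open>Supplies the single-preimage condition, with 0 as critical point.\<close>

lemma H_map_eq_c_iff: "K > 1 \<Longrightarrow> H_map K \<theta> c z = c \<longleftrightarrow> z = 0"
  using inj_stretch[of K \<theta>] linear_0[OF linear_stretch[of K \<theta>]]
  by (simp add: H_map_eq) (metis injD)

text \<open>The pieces are the images of the bounded orbit set under the two inverse branches
  obtained from a square root and its negative.\<close>

lemma H_map_splitting:
  assumes K: "K > 1" and c: "c \<notin> bounded_orbit_set (H_map K \<theta> c)"
  obtains A B where "compact A" "compact B" "A \<inter> B = {}"
    "A \<union> B = bounded_orbit_set (H_map K \<theta> c)"
    "H_map K \<theta> c ` A = bounded_orbit_set (H_map K \<theta> c)"
    "H_map K \<theta> c ` B = bounded_orbit_set (H_map K \<theta> c)"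
proof -
  interpret expanding_open_map "H_map K \<theta> c" "norm c + 2"
    by (rule expanding_open_map_H_map[OF K])
  let ?BO = "bounded_orbit_set (H_map K \<theta> c)"
  let ?L = "stretch K \<theta>"
  have "connected_component_set (- ?BO) c \<in> components (- ?BO)"
    using c by (intro componentsI) simp
  then have "\<not> bounded (connected_component_set (- ?BO) c)"
    by (rule unbounded_component_escaping)
  then obtain s where s: "continuous_on ?BO s" "\<And>w. w \<in> ?BO \<Longrightarrow> (s w)\<^sup>2 = w - c"
    using continuous_square_root_off_unbounded_component[OF compact_bounded_orbit_set c] by blast
  define M where "M = inv ?L"
  have M: "linear M" "M (?L z) = z" "?L (M z) = z" for z
    by (simp_all add: M_def inj_linear_imp_inv_linear linear_stretch inj_stretch surj_stretch
        surj_f_inv_f K)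
  define A where "A = (\<lambda>w. M (s w)) ` ?BO"
  define B where "B = (\<lambda>w. M (- s w)) ` ?BO"
  have H_M: "H_map K \<theta> c (M (s w)) = w" "H_map K \<theta> c (M (- s w)) = w" if "w \<in> ?BO" for w
    using s(2)[OF that] by (simp_all add: H_map_eq M)
  have contM: "continuous_on X M" for X
    using M(1) by (simp add: linear_continuous_on linear_linear)
  show thesis
  proof
    show "compact A"
      unfolding A_def
      by (intro compact_continuous_image compact_bounded_orbit_set
          continuous_on_compose2[OF contM s(1) subset_UNIV])
    show "compact B"
      unfolding B_def
      by (intro compact_continuous_image compact_bounded_orbit_set
          continuous_on_compose2[OF contM continuous_on_minus[OF s(1)] subset_UNIV])
    show "A \<inter> B = {}"
    proof (rule ccontr)
      \<comment> \<open>Applying the map to a common point gives \<open>v = w\<close>, so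
        \<open>s w = 0\<close> and \<open>w = c\<close>, which is not in \<open>?BO\<close>.\<close>
      assume "A \<inter> B \<noteq> {}"
      then obtain v w where vw: "v \<in> ?BO" "w \<in> ?BO" "M (s v) = M (- s w)"
        by (auto simp: A_def B_def)
      then have "v = w"
        using H_M by metis
      moreover have "s v = - s w"
        using vw(3) M(3) by metis
      ultimately have "s w = 0" by simp
      then show False
        using s(2)[OF vw(2)] vw(2) c by simp
    qed
    show "A \<union> B = ?BO"
    proof
      have "z \<in> ?BO" if "H_map K \<theta> c z \<in> ?BO" for z
        using that vimage_bounded_orbit_set by blast
      then show "A \<union> B \<subseteq> ?BO"
        using H_M by (auto simp: A_def B_def)
    next
      show "?BO \<subseteq> A \<union> B"
      proof
        fix z assume "z \<in> ?BO"
        then have w: "H_map K \<theta> c z \<in> ?BO"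
          using vimage_bounded_orbit_set by blast
        have "(?L z)\<^sup>2 = (s (H_map K \<theta> c z))\<^sup>2"
          using s(2)[OF w] by (simp add: H_map_eq)
        then have "?L z = s (H_map K \<theta> c z) \<or> ?L z = - s (H_map K \<theta> c z)"
          by (simp add: power2_eq_iff)
        then have "z = M (s (H_map K \<theta> c z)) \<or> z = M (- s (H_map K \<theta> c z))"
          using M(2) by metis
        with w show "z \<in> A \<union> B"
          unfolding A_def B_def by blast
      qed
    qed
    show "H_map K \<theta> c ` A = ?BO" "H_map K \<theta> c ` B = ?BO"
      using H_M by (force simp: A_def B_def image_image)+
  qed
qed

theorem theorem1p2:
  fixes K \<theta> :: real and c :: complex
  assumes "K > 1" and "\<theta> \<in> {- pi / 2 <.. pi / 2}"
  shows "(c \<in> mandelbrot_set K \<theta> \<longrightarrow>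
            connected (frontier (escaping_set (H_map K \<theta> c)))) \<and>
         (c \<notin> mandelbrot_set K \<theta> \<longrightarrow>
            uncountable (components (frontier (escaping_set (H_map K \<theta> c)))))"
proof -
  interpret expanding_open_map "H_map K \<theta> c" "norm c + 2"
    by (rule expanding_open_map_H_map[OF assms(1)])
  let ?BO = "bounded_orbit_set (H_map K \<theta> c)"
  have frontier: "frontier (escaping_set (H_map K \<theta> c)) = frontier ?BO"
    by (simp add: escaping_set_eq frontier_complement)
  have H0: "H_map K \<theta> c 0 = c"
    by (simp add: H_map_eq_c_iff assms(1))
  \<comment> \<open>Complete invariance moves the condition from 0 to its image
    \<open>c\<close>.\<close>
  then have mandelbrot: "c \<in> mandelbrot_set K \<theta> \<longleftrightarrow> c \<in> ?BO"
    using vimage_bounded_orbit_set by (metis mandelbrot_set_def mem_Collect_eq vimage_eq)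
  show ?thesis
    unfolding frontier mandelbrot
  proof (intro conjI impI)
    assume "c \<in> ?BO"
    then have "connected ?BO"
      using connected_bounded_orbit_set[of 0] H0 H_map_eq_c_iff[OF assms(1)] by metis
    \<comment> \<open>Unicoherence: a connected set with connected complement has connected
      frontier.\<close>
    then show "connected (frontier ?BO)"
      by (intro connected_frontier_simple connected_Compl_bounded_orbit_set)
  next
    assume "c \<notin> ?BO"
    then obtain A B where "compact A" "compact B" "A \<inter> B = {}" "A \<union> B = ?BO"
      "H_map K \<theta> c ` A = ?BO" "H_map K \<theta> c ` B = ?BO"
      by (rule H_map_splitting[OF assms(1)])
    then show "uncountable (components (frontier ?BO))"
      by (rule uncountable_components_of_splitting)
  qed
qed

end
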